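(* Let $m\ge2$ be an integer and $q_1,\dots,q_m\in[1,2]$ with $\frac1{q_1}+\cdots+\frac1{q_m}=\frac{m+1}{2}$ and \[ \max_i q_i<\frac{2m^2-4m+2}{m^2-m-1}. \] Then \[ B^{\mathbb K}_{m,(q_1,\dots,q_m)}\le\prod_{j=2}^m A_{\frac{2j-2}{j}}^{-1}. \]
   Context: $\mathbb K=\mathbb R$ or $\mathbb C$; $e_1,\dots,e_n$ denote the canonical unit vectors. For $(q_1,\dots,q_m)\in[1,2]^m$ with $\sum_k 1/q_k=\frac{m+1}{2}$, $B^{\mathbb K}_{m,(q_1,\dots,q_m)}$ denotes the optimal (smallest) constant $C\ge 1$ such that for every positive integer $n$ and every $m$-linear form $T:\ell_\infty^n\times\cdots\times\ell_\infty^n\to\mathbb K$, \[ \Big(\sum_{j_1=1}^n\Big(\cdots\Big(\sum_{j_m=1}^n|T(e_{j_1},\dots,e_{j_m})|^{q_m}\Big)^{\frac{q_{m-1}}{q_m}}\cdots\Big)^{\frac{q_1}{q_2}}\Big)^{\frac1{q_1}}\le C\|T\|. \] For $0<q<\infty$, $A_q$ denotes the optimal constant in the lower Khinchine inequality $A_q(\sum_j|a_j|^2)^{1/2}\le (\mathbb E|\sum_j a_j\varepsilon_j|^q)^{1/q}$ for all finite scalar sequences, where for $\mathbb K=\mathbb R$ the $\varepsilon_j$ are independent Rademacher variables and for $\mathbb K=\mathbb C$ independent Steinhaus variables. Known values: for $\mathbb K=\mathbb C$, $q\in[1,2]$: $A_q=\Gamma(\frac{q+2}{2})^{1/q}$;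 for $\mathbb K=\mathbb R$: $A_q=2^{\frac12-\frac1q}$ if $q<q_0\approx1.8474$ and $A_q=\sqrt2(\Gamma(\frac{1+q}{2})/\sqrt\pi)^{1/q}$ if $q>q_0$, with $\Gamma(\frac{q_0+1}{2})=\frac{\sqrt\pi}2$. *)

theory Defs
  imports "HOL-Probability.Probability"
begin

text \<open>The scalar field: real or complex. All scalars are represented as complex numbers;
  in the real case coefficients, points and sequences are required to be real.\<close>
datatype scalar_field = RealK | ComplexK

definition in_field :: "scalar_field \<Rightarrow> complex \<Rightarrow> bool" where
  "in_field K z \<longleftrightarrow> (K = RealK \<longrightarrow> z \<in> \<real>)"

text \<open>An m-linear form T on (l_infty^n)^m is represented by its coefficients
  c js = T(e_{js!0},...,e_{js!(m-1)}), for index lists js of length m with entries < n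
  (indices 0-based).\<close>
definition idx :: "nat \<Rightarrow> nat \<Rightarrow> nat list set" where
  "idx m n = {js. length js = m \<and> set js \<subseteq> {..<n}}"

definition form_eval :: "nat \<Rightarrow> nat \<Rightarrow> (nat list \<Rightarrow> complex) \<Rightarrow> (nat \<Rightarrow> nat \<Rightarrow> complex) \<Rightarrow> complex" where
  "form_eval m n c x = (\<Sum>js\<in>idx m n. c js * (\<Prod>k<m. x k (js ! k)))"

definition form_norm :: "scalar_field \<Rightarrow> nat \<Rightarrow> nat \<Rightarrow> (nat list \<Rightarrow> complex) \<Rightarrow> real" where
  "form_norm K m n c = Sup {norm (form_eval m n c x) | x.
      \<forall>k<m. \<forall>i<n. norm (x k i) \<le> 1 \<and> in_field K (x k i)}"

text \<open>Mixed norm: the innermost sum is over the last index with exponent q_m, etc.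
  The exponent for the (0-based) coordinate k is q k.\<close>
fun mixnorm :: "(nat \<Rightarrow> real) \<Rightarrow> nat \<Rightarrow> (nat list \<Rightarrow> real) \<Rightarrow> nat \<Rightarrow> nat list \<Rightarrow> real" where
  "mixnorm q n f 0 p = f p"
| "mixnorm q n f (Suc r) p =
     (\<Sum>i<n. mixnorm q n f r (p @ [i]) powr q (length p)) powr (1 / q (length p))"

definition mixed_norm :: "nat \<Rightarrow> (nat \<Rightarrow> real) \<Rightarrow> nat \<Rightarrow> (nat list \<Rightarrow> complex) \<Rightarrow> real" where
  "mixed_norm m q n c = mixnorm q n (\<lambda>js. norm (c js)) m []"

definition BH_const :: "scalar_field \<Rightarrow> nat \<Rightarrow> (nat \<Rightarrow> real) \<Rightarrow> real" where
  "BH_const K m q = Inf {C. C \<ge> 1 \<and> (\<forall>n c. n > 0 \<longrightarrow> (\<forall>js. in_field K (c js)) \<longrightarrow>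
       mixed_norm m q n c \<le> C * form_norm K m n c)}"

definition eps_dist :: "scalar_field \<Rightarrow> complex measure" where
  "eps_dist K = (if K = RealK then measure_pmf (pmf_of_set {-1, 1})
       else distr (uniform_measure lborel {0..1}) borel (\<lambda>t. cis (2 * pi * t)))"

definition khin_moment :: "scalar_field \<Rightarrow> real \<Rightarrow> nat \<Rightarrow> (nat \<Rightarrow> complex) \<Rightarrow> real" where
  "khin_moment K q N a =
     (integral\<^sup>L (PiM {..<N} (\<lambda>_. eps_dist K)) (\<lambda>e. norm (\<Sum>j<N. a j * e j) powr q)) powr (1 / q)"

definition khin_const :: "scalar_field \<Rightarrow> real \<Rightarrow> real" where
  "khin_const K q = Sup {A. \<forall>N a. (\<forall>j. in_field K (a j)) \<longrightarrow>
       A * sqrt (\<Sum>j<N. (norm (a j))\<^sup>2) \<le> khin_moment K q N a}"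

end

theory Submission
  imports Defs
begin

text \<open>
  Put \<open>p = (2m - 2)/m\<close>, the Bohnenblust--Hille exponent of \<open>(m - 1)\<close>-linear forms. Averaging the
  \<open>(m - 1)\<close>-linear inequality over random signs in one slot and applying Khinchine's inequality
  bounds the mixed norm with exponent 2 in that slot and \<open>p\<close> in all others, at the cost of a factor
  \<open>1/A\<^sub>p\<close>; by Minkowski's inequality the slot may be any of the \<open>m\<close>. The hypothesis on the
  maximum forces \<open>p \<le> q\<^sub>k \<le> 2\<close>, so \<open>(1/q\<^sub>1, \<dots>, 1/q\<^sub>m)\<close> is a convex combination of these \<open>m\<close>
  exponents and Hoelder's inequality for mixed norms interpolates. The choice of all \<open>q\<^sub>k\<close>
  equal to \<open>2m/(m + 1)\<close> is the induction step for the Bohnenblust--Hille inequality itself.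
\<close>

subsection \<open>Hoelder and Minkowski inequalities for finite sums\<close>

text \<open>Jensen's inequality for the exponential function at the points \<open>ln (x k)\<close>,
  once no \<open>x k\<close> vanishes.\<close>

lemma weighted_arith_geom_mean:
  fixes x l :: "'a \<Rightarrow> real"
  assumes "finite S" and x: "\<And>k. k \<in> S \<Longrightarrow> 0 \<le> x k" and l: "\<And>k. k \<in> S \<Longrightarrow> 0 \<le> l k"
    and "sum l S = 1"
  shows "(\<Prod>k\<in>S. x k powr l k) \<le> (\<Sum>k\<in>S. l k * x k)"
proof (cases "\<exists>k\<in>S. x k = 0")
  case True
  \<comment> \<open>Since \<open>0 powr 0 = 0\<close>, a vanishing \<open>x k\<close> annihilates
    the product even when its weight is 0.\<close>
  then have "(\<Prod>k\<in>S. x k powr l k) = 0"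
    using \<open>finite S\<close> by force
  then show ?thesis
    by (simp add: sum_nonneg x l)
next
  case False
  then have pos: "0 < x k" if "k \<in> S" for k
    using x that by (metis less_eq_real_def)
  have "S \<noteq> {}"
    using assms by auto
  have "(\<Prod>k\<in>S. x k powr l k) = exp (\<Sum>k\<in>S. l k *\<^sub>R ln (x k))"
    using \<open>finite S\<close> pos by (simp add: exp_sum powr_def less_imp_neq [symmetric])
  also have "\<dots> \<le> (\<Sum>k\<in>S. l k * exp (ln (x k)))"
    by (rule convex_on_sum[OF _ _ exp_convex]) (use assms \<open>S \<noteq> {}\<close> in auto)
  also have "\<dots> = (\<Sum>k\<in>S. l k * x k)"
    using pos by simp
  finally show ?thesis .
qed

text \<open>Each \<open>b k\<close> is divided by its total \<open>B k\<close>. The weighted mean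
  inequality at every \<open>i\<close>, summed over \<open>I\<close>, then leaves the sum of the
  weights, which is 1.\<close>

lemma Hoelder_prod_powr:
  fixes b :: "'k \<Rightarrow> 'i \<Rightarrow> real" and l :: "'k \<Rightarrow> real"
  assumes S: "finite S" and I: "finite I" and b: "\<And>k i. k \<in> S \<Longrightarrow> i \<in> I \<Longrightarrow> 0 \<le> b k i"
    and l: "\<And>k. k \<in> S \<Longrightarrow> 0 \<le> l k" and l1: "sum l S = 1"
  shows "(\<Sum>i\<in>I. \<Prod>k\<in>S. b k i powr l k) \<le> (\<Prod>k\<in>S. (\<Sum>i\<in>I. b k i) powr l k)"
proof (cases "\<exists>k\<in>S. (\<Sum>i\<in>I. b k i) = 0")
  case True
  then obtain k where k: "k \<in> S" "(\<Sum>i\<in>I. b k i) = 0"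
    by blast
  then have "b k i = 0" if "i \<in> I" for i
    using that I b by (simp add: sum_nonneg_eq_0_iff)
  then have "(\<Prod>k\<in>S. b k i powr l k) = 0" if "i \<in> I" for i
    using S k that by (intro prod_zero) auto
  then have "(\<Sum>i\<in>I. \<Prod>k\<in>S. b k i powr l k) = 0"
    by simp
  then show ?thesis
    by (simp add: prod_nonneg)
next
  case False
  define B where "B = (\<lambda>k. \<Sum>i\<in>I. b k i)"
  have B: "0 < B k" if "k \<in> S" for k
    using False b that by (metis B_def less_eq_real_def sum_nonneg)
  have "(\<Sum>i\<in>I. \<Prod>k\<in>S. b k i powr l k)
      = (\<Sum>i\<in>I. (\<Prod>k\<in>S. B k powr l k) * (\<Prod>k\<in>S. (b k i / B k) powr l k))"
    using B by (intro sum.cong refl)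
      (auto simp flip: prod.distrib powr_mult intro!: prod.cong dest: less_imp_neq[OF B])
  also have "\<dots> \<le> (\<Sum>i\<in>I. (\<Prod>k\<in>S. B k powr l k) * (\<Sum>k\<in>S. l k * (b k i / B k)))"
    by (intro sum_mono mult_left_mono weighted_arith_geom_mean prod_nonneg)
      (use assms B in \<open>auto simp: less_imp_le\<close>)
  also have "\<dots> = (\<Prod>k\<in>S. B k powr l k) * (\<Sum>k\<in>S. l k * ((\<Sum>i\<in>I. b k i) / B k))"
    by (subst sum_distrib_left[symmetric], subst sum.swap)
      (simp add: sum_distrib_left sum_divide_distrib)
  also have "(\<Sum>k\<in>S. l k * ((\<Sum>i\<in>I. b k i) / B k)) = sum l S"
  proof (rule sum.cong)
    fix k assume "k \<in> S"
    then show "l k * ((\<Sum>i\<in>I. b k i) / B k) = l k"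
      using B[of k] by (simp add: B_def)
  qed simp
  finally show ?thesis
    by (simp add: l1 B_def)
qed

text \<open>One factor of \<open>S j powr s\<close> is written out as a sum over \<open>t\<close>,
  Hoelder's inequality is applied for each \<open>t\<close>, and \<open>W powr (1 - 1 / s)\<close>
  is cancelled.\<close>

lemma Minkowski_powr:
  fixes x :: "'t \<Rightarrow> 'j \<Rightarrow> real"
  assumes T: "finite T" and J: "finite J" and x: "\<And>t j. t \<in> T \<Longrightarrow> j \<in> J \<Longrightarrow> 0 \<le> x t j"
    and s: "1 \<le> s"
  shows "(\<Sum>j\<in>J. (\<Sum>t\<in>T. x t j) powr s) powr (1 / s) \<le> (\<Sum>t\<in>T. (\<Sum>j\<in>J. x t j powr s) powr (1 / s))"
proof -
  define S where "S = (\<lambda>j. \<Sum>t\<in>T. x t j)"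
  define W where "W = (\<Sum>j\<in>J. S j powr s)"
  define N where "N = (\<lambda>t. (\<Sum>j\<in>J. x t j powr s) powr (1 / s))"
  have S0: "0 \<le> S j" if "j \<in> J" for j
    using that x by (simp add: S_def sum_nonneg)
  have W0: "0 \<le> W"
    by (simp add: W_def sum_nonneg)
  have hoelder: "(\<Sum>j\<in>J. x t j * S j powr (s - 1)) \<le> N t * W powr (1 - 1 / s)" if t: "t \<in> T" for t
  proof -
    \<comment> \<open>Indexing by \<open>bool\<close> gives Hoelder's inequality for two functions,
      with weights \<open>1 / s\<close> and \<open>1 - 1 / s\<close>; the case \<open>s = 1\<close>
      is included.\<close>
    let ?b = "\<lambda>(h::bool) j. if h then x t j powr s else S j powr s"
    let ?l = "\<lambda>h::bool. if h then 1 / s else 1 - 1 / s"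
    have "(\<Sum>j\<in>J. \<Prod>h\<in>UNIV. ?b h j powr ?l h) \<le> (\<Prod>h\<in>UNIV. (\<Sum>j\<in>J. ?b h j) powr ?l h)"
      by (rule Hoelder_prod_powr) (use J s in \<open>auto simp: UNIV_bool\<close>)
    moreover have "(\<Prod>h\<in>UNIV. ?b h j powr ?l h) = x t j * S j powr (s - 1)" if "j \<in> J" for j
      using x[OF t that] s by (simp add: UNIV_bool powr_powr algebra_simps)
    ultimately show ?thesis
      by (simp add: UNIV_bool N_def W_def mult.commute)
  qed
  have "W = (\<Sum>j\<in>J. \<Sum>t\<in>T. x t j * S j powr (s - 1))"
    unfolding W_def
  proof (rule sum.cong)
    fix j assume "j \<in> J"
    have "S j powr s = S j powr 1 * S j powr (s - 1)"
      unfolding powr_add[symmetric] by simp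
    also have "S j powr 1 = S j"
      using S0 \<open>j \<in> J\<close> by simp
    finally show "S j powr s = (\<Sum>t\<in>T. x t j * S j powr (s - 1))"
      by (simp add: S_def sum_distrib_right)
  qed simp
  also have "\<dots> = (\<Sum>t\<in>T. \<Sum>j\<in>J. x t j * S j powr (s - 1))"
    by (rule sum.swap)
  also have "\<dots> \<le> (\<Sum>t\<in>T. N t * W powr (1 - 1 / s))"
    by (rule sum_mono) (rule hoelder)
  finally have W: "W \<le> (\<Sum>t\<in>T. N t) * W powr (1 - 1 / s)"
    by (simp add: sum_distrib_right)
  have "W powr (1 / s) \<le> (\<Sum>t\<in>T. N t)"
  proof (cases "W = 0")
    case True
    then show ?thesis
      by (simp add: N_def sum_nonneg)
  next
    case False
    with W0 have "0 < W" by simp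
    moreover have "W = W powr (1 / s) * W powr (1 - 1 / s)"
      using \<open>0 < W\<close> by (simp flip: powr_add)
    ultimately show ?thesis
      using W by (metis mult_le_cancel_right_pos powr_gt_zero less_imp_neq)
  qed
  then show ?thesis
    by (simp add: W_def S_def N_def)
qed

subsection \<open>Mixed norms\<close>

lemma mixnorm_nonneg:
  assumes "\<And>js. 0 \<le> f js"
  shows "0 \<le> mixnorm q n f r p"
  using assms by (cases r) auto

text \<open>Hoelder's inequality is applied one coordinate at a time: the induction hypothesis
  treats the inner norms, and \<open>Hoelder_prod_powr\<close> the sum over the first free
  coordinate.\<close>

lemma mixnorm_interpolate:
  fixes v :: "'k \<Rightarrow> nat \<Rightarrow> real"
  assumes S: "finite S" and \<theta>: "\<And>k. k \<in> S \<Longrightarrow> 0 \<le> \<theta> k" and \<theta>1: "sum \<theta> S = 1"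
    and f: "\<And>js. 0 \<le> f js"
    and q: "\<And>i. length p \<le> i \<Longrightarrow> i < length p + r \<Longrightarrow> 0 < q i"
    and v: "\<And>k i. k \<in> S \<Longrightarrow> length p \<le> i \<Longrightarrow> i < length p + r \<Longrightarrow> 0 < v k i"
    and qv: "\<And>i. length p \<le> i \<Longrightarrow> i < length p + r \<Longrightarrow> 1 / q i = (\<Sum>k\<in>S. \<theta> k / v k i)"
  shows "mixnorm q n f r p \<le> (\<Prod>k\<in>S. mixnorm (v k) n f r p powr \<theta> k)"
  using q v qv
proof (induction r arbitrary: p)
  case 0
  show ?case
    using f[of p] \<theta>1 S by (cases "f p = 0") (auto simp: powr_sum[symmetric] prod_nonneg)
next
  case (Suc r)
  define i0 where "i0 = length p"
  define a where "a = (\<lambda>k i. mixnorm (v k) n f r (p @ [i]))"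
  have a0: "0 \<le> a k i" for k i
    by (simp add: a_def mixnorm_nonneg f)
  have q0: "0 < q i0"
    by (rule Suc.prems) (auto simp: i0_def)
  have v0: "0 < v k i0" if "k \<in> S" for k
    by (rule Suc.prems) (use that in \<open>auto simp: i0_def\<close>)
  have qv0: "1 / q i0 = (\<Sum>k\<in>S. \<theta> k / v k i0)"
    by (rule Suc.prems) (auto simp: i0_def)
  \<comment> \<open>The Hoelder weights for this coordinate; the relation for
    \<open>1 / q i0\<close> says exactly that they sum to 1.\<close>
  define l where "l = (\<lambda>k. q i0 * \<theta> k / v k i0)"
  have l1: "sum l S = 1"
  proof -
    have "sum l S = q i0 * (\<Sum>k\<in>S. \<theta> k / v k i0)"
      by (simp add: l_def sum_distrib_left)
    then show ?thesis
      using q0 by (simp flip: qv0)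
  qed
  have IH: "mixnorm q n f r (p @ [i]) \<le> (\<Prod>k\<in>S. a k i powr \<theta> k)" for i
    unfolding a_def by (rule Suc.IH) (use Suc.prems in auto)
  have "(\<Sum>i<n. mixnorm q n f r (p @ [i]) powr q i0)
      \<le> (\<Sum>i<n. (\<Prod>k\<in>S. a k i powr \<theta> k) powr q i0)"
    using q0 by (intro sum_mono powr_mono2 IH mixnorm_nonneg f) auto
  also have "\<dots> = (\<Sum>i<n. \<Prod>k\<in>S. (a k i powr v k i0) powr l k)"
    unfolding prod_powr_distrib l_def powr_powr
    using v0 by (intro sum.cong prod.cong) (auto simp: mult.commute dest: less_imp_neq[OF v0])
  also have "\<dots> \<le> (\<Prod>k\<in>S. (\<Sum>i<n. a k i powr v k i0) powr l k)"
    by (rule Hoelder_prod_powr) (use S \<theta> q0 v0 l1 in \<open>auto simp: l_def less_imp_le\<close>)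
  finally have "mixnorm q n f (Suc r) p \<le> (\<Prod>k\<in>S. (\<Sum>i<n. a k i powr v k i0) powr l k) powr (1 / q i0)"
    unfolding mixnorm.simps i0_def[symmetric]
    using q0 by (intro powr_mono2) (auto intro: sum_nonneg)
  also have "\<dots> = (\<Prod>k\<in>S. mixnorm (v k) n f (Suc r) p powr \<theta> k)"
    unfolding prod_powr_distrib l_def mixnorm.simps powr_powr
    using q0 by (intro prod.cong) (auto simp: a_def i0_def)
  finally show ?case .
qed

lemma finite_idx [simp]: "finite (idx m n)"
  using finite_lists_length_eq[of "{..<n}" m] by (simp add: idx_def conj_commute)

lemma idx_0 [simp]: "idx 0 n = {[]}"
  by (auto simp: idx_def)

lemma sum_idx_Suc: "(\<Sum>t\<in>idx (Suc r) n. g t) = (\<Sum>i<n. \<Sum>t\<in>idx r n. g (i # t))"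
  unfolding sum.cartesian_product
  by (rule sum.reindex_bij_witness[of _ "\<lambda>(i, t). i # t" "\<lambda>t. (hd t, tl t)"])
    (auto simp: idx_def length_Suc_conv)

text \<open>With equal exponents each outer power cancels the root taken one level further in, so
  the nested sums merge. Exponents are read off from the length of the prefix, hence the range of
  \<open>i\<close>.\<close>

lemma mixnorm_const_exponent:
  assumes "0 < p" and f: "\<And>js. 0 \<le> f js"
    and "\<And>i. length pre \<le> i \<Longrightarrow> i < length pre + r \<Longrightarrow> v i = p"
  shows "mixnorm v n f r pre = (\<Sum>t\<in>idx r n. f (pre @ t) powr p) powr (1 / p)"
  using assms(3)
proof (induction r arbitrary: pre)
  case 0
  then show ?case
    using assms by (simp add: powr_powr)
next
  case (Suc r)
  have IH: "mixnorm v n f r (pre @ [i]) = (\<Sum>t\<in>idx r n. f ((pre @ [i]) @ t) powr p) powr (1 / p)" for i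
    by (rule Suc.IH) (use Suc.prems in auto)
  have "v (length pre) = p"
    by (rule Suc.prems) auto
  then show ?case
    using \<open>0 < p\<close> by (simp add: IH powr_powr sum_idx_Suc sum_nonneg)
qed

definition insert_at :: "nat \<Rightarrow> 'a \<Rightarrow> 'a list \<Rightarrow> 'a list" where
  "insert_at k j t = take k t @ j # drop k t"

lemma insert_at_0 [simp]: "insert_at 0 j t = j # t"
  and insert_at_Suc_Cons [simp]: "insert_at (Suc k) j (i # t) = i # insert_at k j t"
  by (simp_all add: insert_at_def)

text \<open>Minkowski's inequality in \<open>\<ell>\<^bsub>2/p\<^esub>\<close> moves the exponent 2 to the innermost position.\<close>

lemma mixnorm_single_two_le:
  assumes p: "0 < p" "p \<le> 2" and f: "\<And>js. 0 \<le> f js"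
    and "k \<le> r"
    and "\<And>i. length pre \<le> i \<Longrightarrow> i \<le> length pre + r \<Longrightarrow> v i = (if i = length pre + k then 2 else p)"
  shows "mixnorm v n f (Suc r) pre
    \<le> (\<Sum>t\<in>idx r n. (\<Sum>j<n. (f (pre @ insert_at k j t))\<^sup>2) powr (p / 2)) powr (1 / p)"
  using assms(4,5)
proof (induction k arbitrary: pre r)
  case 0
  have v: "v (length pre) = 2"
    using 0 by auto
  have inner: "mixnorm v n f r (pre @ [j]) = (\<Sum>t\<in>idx r n. f ((pre @ [j]) @ t) powr p) powr (1 / p)" for j
    using p f 0 by (intro mixnorm_const_exponent) auto
  \<comment> \<open>The powers are regrouped as a norm with exponent \<open>2 / p\<close>, which is
    at least 1, of a sum over \<open>t\<close> of nonnegative functions of \<open>j\<close>.\<close>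
  have "mixnorm v n f (Suc r) pre
      = ((\<Sum>j<n. (\<Sum>t\<in>idx r n. f (pre @ j # t) powr p) powr (2 / p)) powr (1 / (2 / p))) powr (1 / p)"
    using p by (simp add: inner v powr_powr)
  also have "\<dots> \<le> (\<Sum>t\<in>idx r n. (\<Sum>j<n. (f (pre @ j # t) powr p) powr (2 / p)) powr (1 / (2 / p))) powr (1 / p)"
    using p by (intro powr_mono2 Minkowski_powr) auto
  also have "\<dots> = (\<Sum>t\<in>idx r n. (\<Sum>j<n. (f (pre @ j # t))\<^sup>2) powr (p / 2)) powr (1 / p)"
    using p f by (simp add: powr_powr)
  finally show ?case
    by simp
next
  case (Suc k)
  then obtain r' where r: "r = Suc r'" "k \<le> r'"
    by (cases r) auto
  have v: "v (length pre) = p"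
    using Suc.prems by auto
  define G where "G = (\<lambda>i. \<Sum>t\<in>idx r' n. (\<Sum>j<n. (f ((pre @ [i]) @ insert_at k j t))\<^sup>2) powr (p / 2))"
  have G0: "0 \<le> G i" for i
    by (simp add: G_def sum_nonneg)
  have IH: "mixnorm v n f (Suc r') (pre @ [i]) \<le> G i powr (1 / p)" for i
    unfolding G_def by (rule Suc.IH) (use Suc.prems r in auto)
  \<comment> \<open>A coordinate in front of the slot with exponent 2 carries \<open>p\<close>, so
    its outer power undoes the root \<open>1 / p\<close> of the inner bound.\<close>
  have "mixnorm v n f (Suc r) pre \<le> (\<Sum>i<n. (G i powr (1 / p)) powr p) powr (1 / p)"
    unfolding mixnorm.simps(2)[of _ _ _ r] v unfolding r
    using p by (intro powr_mono2 sum_mono IH mixnorm_nonneg f sum_nonneg) auto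
  also have "\<dots> = (\<Sum>t\<in>idx r n. (\<Sum>j<n. (f (pre @ insert_at (Suc k) j t))\<^sup>2) powr (p / 2)) powr (1 / p)"
    using p G0 by (simp add: r sum_idx_Suc powr_powr G_def)
  finally show ?case .
qed

subsection \<open>Multilinear forms\<close>

text \<open>\<open>Sup\<close> on the reals is informative only for bounded sets. The bound here is
  the sum of the moduli of the coefficients.\<close>

lemma bdd_above_form_values:
  "bdd_above {norm (form_eval m n c x) | x. \<forall>k<m. \<forall>i<n. norm (x k i) \<le> 1 \<and> in_field K (x k i)}"
proof (rule bdd_aboveI)
  fix y
  assume "y \<in> {norm (form_eval m n c x) | x. \<forall>k<m. \<forall>i<n. norm (x k i) \<le> 1 \<and> in_field K (x k i)}"
  then obtain x where x: "\<And>k i. k < m \<Longrightarrow> i < n \<Longrightarrow> norm (x k i) \<le> 1"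
    and y: "y = norm (form_eval m n c x)"
    by blast
  have "norm (c js * (\<Prod>k<m. x k (js ! k))) \<le> norm (c js)" if "js \<in> idx m n" for js
  proof -
    have "(\<Prod>k<m. norm (x k (js ! k))) \<le> 1"
      using that by (intro prod_le_1) (force intro!: x simp: idx_def)+
    then show ?thesis
      by (simp add: norm_mult prod_norm[symmetric] mult_left_le)
  qed
  then show "y \<le> (\<Sum>js\<in>idx m n. norm (c js))"
    unfolding y form_eval_def by (rule order_trans[OF norm_sum sum_mono])
qed

lemma form_eval_le_form_norm:
  assumes "\<And>k i. k < m \<Longrightarrow> i < n \<Longrightarrow> norm (x k i) \<le> 1 \<and> in_field K (x k i)"
  shows "norm (form_eval m n c x) \<le> form_norm K m n c"
  unfolding form_norm_def
  by (rule cSup_upper[OF _ bdd_above_form_values]) (use assms in blast)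

lemma form_norm_le:
  assumes "\<And>x. (\<And>k i. k < m \<Longrightarrow> i < n \<Longrightarrow> norm (x k i) \<le> 1 \<and> in_field K (x k i))
      \<Longrightarrow> norm (form_eval m n c x) \<le> C"
  shows "form_norm K m n c \<le> C"
  unfolding form_norm_def
proof (rule cSup_least)
  have "norm (form_eval m n c (\<lambda>_ _. 0)) \<in>
      {norm (form_eval m n c x) | x. \<forall>k<m. \<forall>i<n. norm (x k i) \<le> 1 \<and> in_field K (x k i)}"
    by (rule CollectI, rule exI[of _ "\<lambda>_ _. 0"]) (simp add: in_field_def)
  then show "{norm (form_eval m n c x) | x. \<forall>k<m. \<forall>i<n. norm (x k i) \<le> 1 \<and> in_field K (x k i)} \<noteq> {}"
    by (metis empty_iff)
qed (use assms in blast)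

lemma form_norm_nonneg: "0 \<le> form_norm K m n c"
  by (rule order_trans[OF norm_ge_zero form_eval_le_form_norm[where x = "\<lambda>_ _. 0"]])
    (simp add: in_field_def)

text \<open>The coefficients of the form \<open>T(\<dots>, e, \<dots>)\<close> with the vector \<open>e\<close> put into slot \<open>k\<close>.\<close>

definition slice :: "nat \<Rightarrow> nat \<Rightarrow> (nat \<Rightarrow> complex) \<Rightarrow> (nat list \<Rightarrow> complex) \<Rightarrow> nat list \<Rightarrow> complex" where
  "slice n k e c t = (\<Sum>j<n. c (insert_at k j t) * e j)"

lemma length_insert_at: "length (insert_at k j t) = Suc (length t)"
  by (simp add: insert_at_def)

lemma nth_insert_at:
  assumes "k \<le> length t"
  shows "insert_at k j t ! l = (if l < k then t ! l else if l = k then j else t ! (l - 1))"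
  using assms by (auto simp: insert_at_def nth_append nth_Cons' not_less)

lemma prod_insert_at:
  fixes y :: "nat \<Rightarrow> 'b \<Rightarrow> 'a::comm_monoid_mult"
  assumes "k \<le> m" "length t = m"
  shows "(\<Prod>l<Suc m. (if l < k then x l else if l = k then e else x (l - 1)) (insert_at k j t ! l))
    = e j * (\<Prod>l<m. x l (t ! l))"
proof -
  \<comment> \<open>\<open>h\<close> enumerates the slots other than \<open>k\<close> in increasing
    order.\<close>
  define h where "h = (\<lambda>l. if l < k then l else Suc l)"
  define G where "G = (\<lambda>l. (if l < k then x l else if l = k then e else x (l - 1)) (insert_at k j t ! l))"
  have sub: "l \<in> h ` {..<m}" if "l < Suc m" "l \<noteq> k" for l
    using that assms(1) by (intro image_eqI[of _ _ "if l < k then l else l - 1"]) (auto simp: h_def)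
  have eq: "{..<Suc m} = insert k (h ` {..<m})"
  proof (intro equalityI subsetI)
    fix l assume "l \<in> {..<Suc m}"
    then show "l \<in> insert k (h ` {..<m})"
      using sub[of l] by blast
  qed (use assms(1) in \<open>auto simp: h_def split: if_splits\<close>)
  have "k \<notin> h ` {..<m}" and "inj_on h {..<m}"
    by (auto simp: h_def inj_on_def split: if_splits)
  then have "(\<Prod>l<Suc m. G l) = G k * (\<Prod>l<m. G (h l))"
    unfolding eq by (simp add: prod.reindex)
  also have "(\<Prod>l<m. G (h l)) = (\<Prod>l<m. x l (t ! l))"
    using assms by (intro prod.cong) (auto simp: G_def h_def nth_insert_at)
  finally show ?thesis
    using assms by (simp add: G_def nth_insert_at)
qed

text \<open>Pairs of a short index \<open>t\<close> and an entry \<open>j\<close> correspond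
  bijectively to long indices through \<open>insert_at k\<close>. Slots behind \<open>k\<close> move
  up by one, hence \<open>x (l - 1)\<close>.\<close>

lemma form_eval_slice:
  assumes "k \<le> m"
  shows "form_eval m n (slice n k e c) x
    = form_eval (Suc m) n c (\<lambda>l. if l < k then x l else if l = k then e else x (l - 1))"
proof -
  let ?y = "\<lambda>l. if l < k then x l else if l = k then e else x (l - 1)"
  have "form_eval m n (slice n k e c) x
      = (\<Sum>(t, j)\<in>idx m n \<times> {..<n}. c (insert_at k j t) * (e j * (\<Prod>l<m. x l (t ! l))))"
    by (simp add: form_eval_def slice_def sum_distrib_right sum.cartesian_product mult.assoc)
  also have "\<dots> = (\<Sum>js\<in>idx (Suc m) n. c js * (\<Prod>l<Suc m. ?y l (js ! l)))"
  proof (rule sum.reindex_bij_witness[where i = "\<lambda>js. (take k js @ drop (Suc k) js, js ! k)"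
        and j = "\<lambda>(t, j). insert_at k j t"])
    fix a assume "a \<in> idx m n \<times> {..<n}"
    then obtain t j where a: "a = (t, j)" "length t = m" "set t \<subseteq> {..<n}" "j < n"
      by (auto simp: idx_def)
    show "(case a of (t, j) \<Rightarrow> insert_at k j t) \<in> idx (Suc m) n"
      using a assms set_take_subset[of k t] set_drop_subset[of k t]
      by (auto simp: idx_def length_insert_at) (auto simp: insert_at_def)
    show "(take k (case a of (t, j) \<Rightarrow> insert_at k j t) @ drop (Suc k) (case a of (t, j) \<Rightarrow> insert_at k j t),
        (case a of (t, j) \<Rightarrow> insert_at k j t) ! k) = a"
      using a assms by (simp add: insert_at_def nth_append)
    show "c (case a of (t, j) \<Rightarrow> insert_at k j t) * (\<Prod>l<Suc m. ?y l ((case a of (t, j) \<Rightarrow> insert_at k j t) ! l))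
        = (case a of (t, j) \<Rightarrow> c (insert_at k j t) * (e j * (\<Prod>l<m. x l (t ! l))))"
      using a assms by (simp only: prod.case prod_insert_at[OF assms])
  next
    fix js assume "js \<in> idx (Suc m) n"
    then have js: "length js = Suc m" "set js \<subseteq> {..<n}"
      by (auto simp: idx_def)
    then have "js ! k \<in> {..<n}"
      using assms by (intro subsetD[OF js(2)] nth_mem) simp
    then show "(take k js @ drop (Suc k) js, js ! k) \<in> idx m n \<times> {..<n}"
      using js assms set_take_subset[of k js] set_drop_subset[of "Suc k" js]
      by (auto simp: idx_def)
    have "insert_at k (js ! k) (take k js @ drop (Suc k) js) = take k js @ js ! k # drop (Suc k) js"
      using js assms by (simp add: insert_at_def)
    then show "(case (take k js @ drop (Suc k) js, js ! k) of (t, j) \<Rightarrow> insert_at k j t) = js"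
      using js(1) assms id_take_nth_drop[of k js] by simp
  qed
  finally show ?thesis
    by (simp add: form_eval_def)
qed

text \<open>Putting \<open>e\<close> into slot \<open>k\<close> turns an admissible point for the
  sliced form into an admissible point for the full form with the same value.\<close>

lemma form_norm_slice_le:
  assumes "k \<le> m" and e: "\<And>j. j < n \<Longrightarrow> norm (e j) \<le> 1 \<and> in_field K (e j)"
  shows "form_norm K m n (slice n k e c) \<le> form_norm K (Suc m) n c"
proof (rule form_norm_le)
  fix x :: "nat \<Rightarrow> nat \<Rightarrow> complex"
  assume x: "\<And>k i. k < m \<Longrightarrow> i < n \<Longrightarrow> norm (x k i) \<le> 1 \<and> in_field K (x k i)"
  show "norm (form_eval m n (slice n k e c) x) \<le> form_norm K (Suc m) n c"
    unfolding form_eval_slice[OF assms(1)]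
    by (rule form_eval_le_form_norm) (use e x assms(1) in auto)
qed

lemma in_field_mult: "in_field K z \<Longrightarrow> in_field K w \<Longrightarrow> in_field K (z * w)"
  by (auto simp: in_field_def)

lemma in_field_sum: "(\<And>i. i \<in> I \<Longrightarrow> in_field K (f i)) \<Longrightarrow> in_field K (sum f I)"
  unfolding in_field_def by (intro impI sum_in_Reals) blast

lemma in_field_slice:
  assumes "\<And>js. in_field K (c js)" "\<And>j. j < n \<Longrightarrow> in_field K (e j)"
  shows "in_field K (slice n k e c t)"
  unfolding slice_def using assms by (intro in_field_sum in_field_mult) auto

text \<open>A linear form attains the sum of the moduli of its coefficients at the vector of
  conjugate signs, which is real if the coefficients are. This starts the induction for the
  Bohnenblust--Hille inequality.\<close>

lemma sum_norm_coeffs_le_form_norm: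
  assumes c: "\<And>js. in_field K (c js)"
  shows "(\<Sum>t\<in>idx 1 n. norm (c t)) \<le> form_norm K 1 n c"
proof -
  define x :: "nat \<Rightarrow> nat \<Rightarrow> complex" where "x = (\<lambda>_ i. cnj (sgn (c [i])))"
  have "cnj (sgn z) \<in> \<real>" if "z \<in> \<real>" for z
    using that by (cases z rule: Reals_cases) (simp_all add: sgn_of_real)
  then have x: "norm (x k i) \<le> 1 \<and> in_field K (x k i)" for k i
    using c[of "[i]"] by (auto simp: x_def norm_sgn in_field_def)
  have "c [i] * cnj (sgn (c [i])) = of_real (norm (c [i]))" for i
    by (cases "c [i] = 0") (simp_all add: sgn_eq complex_norm_square[symmetric] power2_eq_square)
  then have "form_eval 1 n c x = (\<Sum>t\<in>idx 1 n. of_real (norm (c t)))"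
    unfolding One_nat_def form_eval_def sum_idx_Suc by (simp add: x_def)
  then have "norm (form_eval 1 n c x) = (\<Sum>t\<in>idx 1 n. norm (c t))"
    by (simp add: sum_nonneg flip: of_real_sum)
  moreover have "norm (form_eval 1 n c x) \<le> form_norm K 1 n c"
    by (rule form_eval_le_form_norm) (rule x)
  ultimately show ?thesis
    by simp
qed

subsection \<open>Khinchine's inequality\<close>

lemma borel_measurable_cis [measurable]: "(\<lambda>t. cis (2 * pi * t)) \<in> borel_measurable borel"
  by (intro borel_measurable_continuous_onI continuous_intros)

lemma prob_space_eps_dist: "prob_space (eps_dist K)"
proof (cases K)
  case RealK
  then show ?thesis
    by (simp add: eps_dist_def measure_pmf.prob_space_axioms)
next
  case ComplexK
  have "prob_space (uniform_measure lborel {0..1::real})"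
    by (rule prob_space_uniform_measure) auto
  then show ?thesis
    using ComplexK by (auto simp: eps_dist_def intro!: prob_space.prob_space_distr)
qed

lemma borel_measurable_eps_dist [measurable]: "(\<lambda>z. z) \<in> borel_measurable (eps_dist K)"
  by (cases K) (simp_all add: eps_dist_def)

text \<open>Almost everywhere only, because both versions of the measure have the whole complex
  plane as their space.\<close>

lemma AE_eps_dist: "AE z in eps_dist K. norm z = 1 \<and> in_field K z"
proof (cases K)
  case RealK
  then show ?thesis
    unfolding eps_dist_def by (auto simp: AE_measure_pmf_iff in_field_def)
next
  case ComplexK
  then show ?thesis
    unfolding eps_dist_def by (simp add: AE_distr_iff in_field_def)
qed

text \<open>Together with modulus 1, the vanishing mean carries the moment estimates below, which
  treat real and complex signs alike.\<close>

lemma integral_eps_dist: "integral\<^sup>L (eps_dist K) (\<lambda>z. z) = 0"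
proof (cases K)
  case RealK
  have "measure_pmf.expectation (pmf_of_set {- 1, 1}) (\<lambda>z. z)
      = (\<Sum>z\<in>{- 1, 1 :: complex}. pmf (pmf_of_set {- 1, 1}) z *\<^sub>R z)"
    by (rule integral_measure_pmf) (auto split: if_splits)
  then show ?thesis
    using RealK by (simp add: eps_dist_def)
next
  case ComplexK
  have "integral\<^sup>L (eps_dist K) (\<lambda>z. z) = (\<integral>t. cis (2 * pi * t) \<partial>uniform_measure lborel {0..1})"
    using ComplexK by (simp add: eps_dist_def integral_distr)
  also have "\<dots> = (\<integral>t. indicator {0..1} t *\<^sub>R cis (2 * pi * t) \<partial>lborel)"
  proof -
    have "uniform_measure lborel {0..1::real} = density lborel (\<lambda>t. ennreal (indicator {0..1} t))"
      by (simp add: uniform_measure_def divide_ennreal_def ennreal_indicator)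
    then show ?thesis
      by (simp add: integral_density)
  qed
  \<comment> \<open>\<open>cis\<close> has period \<open>2 * pi\<close>, so the antiderivative takes
    the same value at both ends.\<close>
  also have "\<dots> = cis (2 * pi * 1) / (2 * pi * \<i>) - cis (2 * pi * 0) / (2 * pi * \<i>)"
  proof (rule integral_FTC_atLeastAtMost)
    show "((\<lambda>t. cis (2 * pi * t) / (2 * pi * \<i>)) has_vector_derivative cis (2 * pi * x)) (at x within {0..1})" for x
      by (auto intro!: derivative_eq_intros simp: has_vector_derivative_def fun_eq_iff scaleR_conv_of_real field_simps)
  qed (auto intro!: continuous_intros)
  also have "\<dots> = 0"
    by simp
  finally show ?thesis .
qed

section \<open>Finite families of independent random signs\<close>

abbreviation eps_prod :: "scalar_field \<Rightarrow> nat \<Rightarrow> (nat \<Rightarrow> complex) measure" where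
  "eps_prod K N \<equiv> PiM {..<N} (\<lambda>_. eps_dist K)"

lemma prob_space_eps_prod: "prob_space (eps_prod K N)"
  by (intro prob_space_PiM prob_space_eps_dist)

lemma AE_eps_prod: "AE e in eps_prod K N. \<forall>j<N. norm (e j) = 1 \<and> in_field K (e j)"
proof -
  have "AE e in eps_prod K N. norm (e j) = 1 \<and> in_field K (e j)" if "j < N" for j
    using that AE_eps_dist
    by (intro AE_PiM_component[where P = "\<lambda>z. norm z = 1 \<and> in_field K z"] prob_space_eps_dist) auto
  then have "AE e in eps_prod K N. \<forall>j\<in>{..<N}. norm (e j) = 1 \<and> in_field K (e j)"
    by (intro AE_finite_allI) auto
  then show ?thesis
    by (rule eventually_mono) simp
qed

lemma borel_measurable_eps_sum [measurable]:
  "(\<lambda>e. \<Sum>j<N. a j * e j) \<in> borel_measurable (eps_prod K N)"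
proof (intro borel_measurable_sum borel_measurable_times borel_measurable_const)
  fix j assume "j \<in> {..<N}"
  then show "(\<lambda>e. e j) \<in> borel_measurable (eps_prod K N)"
    using measurable_compose[OF measurable_component_singleton[of j "{..<N}" "\<lambda>_. eps_dist K"]
        borel_measurable_eps_dist[of K]] by simp
qed

lemma AE_eps_sum_bound: "AE e in eps_prod K N. norm (\<Sum>j<N. a j * e j) \<le> (\<Sum>j<N. norm (a j))"
  using AE_eps_prod
proof eventually_elim
  case (elim e)
  then have "(\<Sum>j<N. norm (a j * e j)) = (\<Sum>j<N. norm (a j))"
    by (simp add: norm_mult)
  then show ?case
    using norm_sum[of "\<lambda>j. a j * e j" "{..<N}"] by simp
qed

lemma integrable_eps_sum_power: "integrable (eps_prod K N) (\<lambda>e. norm (\<Sum>j<N. a j * e j) ^ r)"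
proof -
  interpret prob_space "eps_prod K N"
    by (rule prob_space_eps_prod)
  show ?thesis
    using AE_eps_sum_bound[where K = K and N = N and a = a]
    by (intro integrable_const_bound[of _ "(\<Sum>j<N. norm (a j)) ^ r"]) (auto elim!: eventually_mono intro: power_mono)
qed

lemma integrable_eps_sum_powr:
  assumes "0 \<le> q"
  shows "integrable (eps_prod K N) (\<lambda>e. norm (\<Sum>j<N. a j * e j) powr q)"
proof -
  interpret prob_space "eps_prod K N"
    by (rule prob_space_eps_prod)
  show ?thesis
    using AE_eps_sum_bound[where K = K and N = N and a = a] assms
    by (intro integrable_const_bound[of _ "(\<Sum>j<N. norm (a j)) powr q"]) (auto elim!: eventually_mono intro: powr_mono2)
qed

section \<open>Second and fourth moments of random sums\<close>

lemma norm_add_square: "(norm (w + z))\<^sup>2 = (norm w)\<^sup>2 + (norm z)\<^sup>2 + 2 * Re (cnj w * z)" for w z :: complex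
  by (simp add: cmod_power2) (simp add: power2_eq_square algebra_simps)

text \<open>Almost everywhere \<open>norm (w + a * z) ^ 2 = s + 2 * R z\<close>, where
  \<open>R\<close> has mean 0. In the square of this, the term \<open>4 * (R z)\<^sup>2\<close> is
  bounded through \<open>\<bar>R z\<bar> \<le> norm w * norm a\<close>.\<close>

lemma
  fixes w a :: complex
  shows integral_eps_translate_square:
    "(\<integral>z. norm (w + a * z) ^ 2 \<partial>eps_dist K) = norm w ^ 2 + norm a ^ 2" (is ?second)
  and integral_eps_translate_fourth:
    "(\<integral>z. norm (w + a * z) ^ 4 \<partial>eps_dist K) \<le> norm w ^ 4 + 6 * norm w ^ 2 * norm a ^ 2 + norm a ^ 4" (is ?fourth)
proof -
  interpret prob_space "eps_dist K"
    by (rule prob_space_eps_dist)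
  define R where "R = (\<lambda>z. Re (cnj w * a * z))"
  define s where "s = norm w ^ 2 + norm a ^ 2"
  have int: "integrable (eps_dist K) (\<lambda>z. z)"
    using AE_eps_dist[of K] by (intro integrable_const_bound[of _ 1]) (auto elim!: eventually_mono)
  have R_int: "integrable (eps_dist K) R"
    unfolding R_def by (intro integrable_Re integrable_mult_right int)
  have "(\<integral>z. R z \<partial>eps_dist K) = Re (\<integral>z. cnj w * a * z \<partial>eps_dist K)"
    unfolding R_def by (intro integral_Re integrable_mult_right int)
  also have "\<dots> = 0"
    by (simp add: integral_eps_dist)
  finally have R0: "(\<integral>z. R z \<partial>eps_dist K) = 0" .
  have sq: "AE z in eps_dist K. norm (w + a * z) ^ 2 = s + 2 * R z"
    using AE_eps_dist
    by eventually_elim (simp add: norm_add_square norm_mult s_def R_def mult.assoc)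
  then have "(\<integral>z. norm (w + a * z) ^ 2 \<partial>eps_dist K) = (\<integral>z. s + 2 * R z \<partial>eps_dist K)"
    by (intro integral_cong_AE) (auto simp: R_def)
  then show ?second
    using R_int R0 by (simp add: prob_space s_def)
  have "AE z in eps_dist K. norm (w + a * z) ^ 4 \<le> s ^ 2 + 4 * norm w ^ 2 * norm a ^ 2 + 4 * s * R z"
    using AE_eps_dist sq
  proof eventually_elim
    case (elim z)
    have "\<bar>R z\<bar> \<le> norm (cnj w * a * z)"
      unfolding R_def by (rule abs_Re_le_cmod)
    then have "\<bar>R z\<bar> \<le> norm w * norm a"
      using elim by (simp add: norm_mult)
    then have "(R z)\<^sup>2 \<le> (norm w * norm a)\<^sup>2"
      by (metis abs_ge_zero power2_abs power_mono)
    moreover have "norm (w + a * z) ^ 4 = (s + 2 * R z)\<^sup>2"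
      using elim by (metis mult_2 numeral_Bit0 power_add power2_eq_square)
    ultimately show ?case
      by (simp add: power2_eq_square algebra_simps)
  qed
  then have "(\<integral>z. norm (w + a * z) ^ 4 \<partial>eps_dist K)
      \<le> (\<integral>z. s ^ 2 + 4 * norm w ^ 2 * norm a ^ 2 + 4 * s * R z \<partial>eps_dist K)"
  proof (rule integral_mono_AE[rotated 2])
    show "integrable (eps_dist K) (\<lambda>z. norm (w + a * z) ^ 4)"
    proof (intro integrable_const_bound[of _ "(norm w + norm a) ^ 4"])
      show "AE z in eps_dist K. norm (norm (w + a * z) ^ 4) \<le> (norm w + norm a) ^ 4"
        using AE_eps_dist
      proof eventually_elim
        case (elim z)
        then show ?case
          using norm_triangle_ineq[of w "a * z"] by (auto simp: norm_mult intro!: power_mono)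
      qed
    qed auto
    show "integrable (eps_dist K) (\<lambda>z. s ^ 2 + 4 * norm w ^ 2 * norm a ^ 2 + 4 * s * R z)"
      using R_int by simp
  qed
  also have "\<dots> = s ^ 2 + 4 * norm w ^ 2 * norm a ^ 2"
    using R_int R0 by (simp add: prob_space)
  also have "\<dots> = norm w ^ 4 + 6 * norm w ^ 2 * norm a ^ 2 + norm a ^ 4"
    by (simp add: s_def power2_eq_square power4_eq_xxxx algebra_simps)
  finally show ?fourth .
qed

text \<open>Fubini's theorem with the last sign integrated innermost; the sum of the first
  \<open>N\<close> terms becomes the translation \<open>w\<close> of the one-sign formulas.\<close>

lemma integral_eps_sum_Suc:
  "(\<integral>e. norm (\<Sum>j<Suc N. a j * e j) ^ r \<partial>eps_prod K (Suc N))
    = (\<integral>e. (\<integral>z. norm ((\<Sum>j<N. a j * e j) + a N * z) ^ r \<partial>eps_dist K) \<partial>eps_prod K N)"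
proof -
  interpret prob_space "eps_dist K"
    by (rule prob_space_eps_dist)
  interpret product_sigma_finite "\<lambda>_. eps_dist K"
    by standard
  have eq: "{..<Suc N} = insert N {..<N}"
    by auto
  have "(\<integral>e. norm (\<Sum>j<Suc N. a j * e j) ^ r \<partial>eps_prod K (Suc N))
    = (\<integral>e. (\<integral>z. norm (\<Sum>j<Suc N. a j * (e(N := z)) j) ^ r \<partial>eps_dist K) \<partial>eps_prod K N)"
    using integrable_eps_sum_power[where K = K and N = "Suc N" and a = a and r = r]
    unfolding eq by (intro product_integral_insert) auto
  then show ?thesis
    by (simp add: add.commute)
qed

lemma integral_eps_sum_square:
  "(\<integral>e. norm (\<Sum>j<N. a j * e j) ^ 2 \<partial>eps_prod K N) = (\<Sum>j<N. (norm (a j))\<^sup>2)"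
proof (induction N)
  case (Suc N)
  interpret prob_space "eps_prod K N"
    by (rule prob_space_eps_prod)
  show ?case
    unfolding integral_eps_sum_Suc integral_eps_translate_square
    using integrable_eps_sum_power[where K = K and N = N and a = a and r = 2] Suc by (simp add: prob_space)
qed simp

text \<open>The constant 3 survives the induction because the cross term
  \<open>6 * s * norm (a N) ^ 2\<close> of the one-sign bound is the one in
  \<open>3 * (s + norm (a N) ^ 2)\<^sup>2\<close>.\<close>

lemma integral_eps_sum_fourth_le:
  "(\<integral>e. norm (\<Sum>j<N. a j * e j) ^ 4 \<partial>eps_prod K N) \<le> 3 * (\<Sum>j<N. (norm (a j))\<^sup>2)\<^sup>2"
proof (induction N)
  case (Suc N)
  interpret prob_space "eps_prod K N"
    by (rule prob_space_eps_prod)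
  define s where "s = (\<Sum>j<N. (norm (a j))\<^sup>2)"
  let ?S = "\<lambda>e. norm (\<Sum>j<N. a j * e j)"
  have "(\<integral>e. norm (\<Sum>j<Suc N. a j * e j) ^ 4 \<partial>eps_prod K (Suc N))
      \<le> (\<integral>e. ?S e ^ 4 + 6 * ?S e ^ 2 * norm (a N) ^ 2 + norm (a N) ^ 4 \<partial>eps_prod K N)"
    unfolding integral_eps_sum_Suc
    by (intro integral_mono' integral_eps_translate_fourth Bochner_Integration.integrable_add
        integrable_mult_left integrable_mult_right integrable_eps_sum_power integrable_const) auto
  also have "\<dots> = (\<integral>e. ?S e ^ 4 \<partial>eps_prod K N) + 6 * s * norm (a N) ^ 2 + norm (a N) ^ 4"
    using integrable_eps_sum_power[where K = K and N = N and a = a and r = 2] integrable_eps_sum_power[where K = K and N = N and a = a and r = 4]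
    by (simp add: prob_space integral_eps_sum_square s_def)
  also have "\<dots> \<le> 3 * s\<^sup>2 + 6 * s * norm (a N) ^ 2 + 3 * norm (a N) ^ 4"
    using Suc zero_le_power[OF norm_ge_zero, of "a N" 4] unfolding s_def by linarith
  also have "\<dots> = 3 * (\<Sum>j<Suc N. (norm (a j))\<^sup>2)\<^sup>2"
  proof -
    have "(\<Sum>j<Suc N. (norm (a j))\<^sup>2) = s + (norm (a N))\<^sup>2"
      by (simp add: s_def)
    then show ?thesis
      by (simp only:) (simp add: power2_eq_square power4_eq_xxxx algebra_simps)
  qed
  finally show ?case .
qed simp

text \<open>Only \<open>khin_const > 0\<close> is needed from this crude bound (otherwise \<open>inverse\<close> could be the junk
  value 0). It comes from integrating \<open>t\<^sup>2\<^sup>-\<^sup>q x\<^sup>q \<ge> x\<^sup>2 - x\<^sup>4/t\<^sup>2\<close>, with the second and fourth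
  moments known.\<close>

lemma khin_moment_lower_bound:
  assumes q: "0 < q" "q \<le> 2"
  shows "2 * (1 / 16) powr (1 / q) * sqrt (\<Sum>j<N. (norm (a j))\<^sup>2) \<le> khin_moment K q N a"
proof -
  define \<sigma> where "\<sigma> = sqrt (\<Sum>j<N. (norm (a j))\<^sup>2)"
  have \<sigma>2: "\<sigma>\<^sup>2 = (\<Sum>j<N. (norm (a j))\<^sup>2)"
    by (simp add: \<sigma>_def sum_nonneg)
  show ?thesis
  proof (cases "\<sigma> = 0")
    case True
    then show ?thesis
      by (simp add: \<sigma>_def khin_moment_def)
  next
    case False
    then have \<sigma>: "0 < \<sigma>"
      by (simp add: \<sigma>_def sum_nonneg less_le)
    \<comment> \<open>With this truncation level the fourth moment term costs at most three quarters
      of \<open>\<sigma>\<^sup>2\<close>, and \<open>t\<^sup>2 / 16\<close> remains.\<close>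
    define t where "t = 2 * \<sigma>"
    have t: "0 < t"
      using \<sigma> by (simp add: t_def)
    \<comment> \<open>For \<open>x \<le> t\<close> the factor \<open>x powr (2 - q)\<close> is at
      most \<open>t powr (2 - q)\<close>; for larger \<open>x\<close> the left side is not
      positive.\<close>
    have pointwise: "x\<^sup>2 - x ^ 4 / t\<^sup>2 \<le> t powr (2 - q) * x powr q" if "0 \<le> x" for x
    proof (cases "x \<le> t")
      case True
      have "x\<^sup>2 = x powr (2 - q) * x powr q"
      proof (cases "x = 0")
        case False
        then show ?thesis
          using that by (simp flip: powr_add)
      qed simp
      also have "\<dots> \<le> t powr (2 - q) * x powr q"
        using True that q by (intro mult_right_mono powr_mono2) auto
      finally show ?thesis
        using t by (smt (verit) divide_nonneg_nonneg zero_le_power that zero_le_power2)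
    next
      case False
      then have "t\<^sup>2 \<le> x\<^sup>2"
        using t by (intro power_mono) auto
      then have "x\<^sup>2 * t\<^sup>2 \<le> x ^ 4"
        using mult_left_mono[of "t\<^sup>2" "x\<^sup>2" "x\<^sup>2"] by (simp flip: power_add)
      then have "x\<^sup>2 - x ^ 4 / t\<^sup>2 \<le> 0"
        using t by (simp add: field_simps)
      then show ?thesis
        by (smt (verit) mult_nonneg_nonneg powr_ge_zero)
    qed
    let ?S = "\<lambda>e. norm (\<Sum>j<N. a j * e j)"
    define E where "E = (\<integral>e. ?S e powr q \<partial>eps_prod K N)"
    have "(\<integral>e. ?S e ^ 2 - ?S e ^ 4 / t\<^sup>2 \<partial>eps_prod K N) \<le> (\<integral>e. t powr (2 - q) * ?S e powr q \<partial>eps_prod K N)"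
      using q by (intro integral_mono Bochner_Integration.integrable_diff integrable_divide integrable_mult_right
        integrable_eps_sum_power integrable_eps_sum_powr pointwise) auto
    also have "(\<integral>e. ?S e ^ 2 - ?S e ^ 4 / t\<^sup>2 \<partial>eps_prod K N)
        = \<sigma>\<^sup>2 - (\<integral>e. ?S e ^ 4 \<partial>eps_prod K N) / t\<^sup>2"
      using integrable_eps_sum_power[where K = K and N = N and a = a and r = 2] integrable_eps_sum_power[where K = K and N = N and a = a and r = 4]
      by (simp add: integral_eps_sum_square \<sigma>2)
    finally have "\<sigma>\<^sup>2 - (\<integral>e. ?S e ^ 4 \<partial>eps_prod K N) / t\<^sup>2 \<le> t powr (2 - q) * E"
      by (simp add: E_def)
    moreover have "(\<integral>e. ?S e ^ 4 \<partial>eps_prod K N) / t\<^sup>2 \<le> 3 * (\<sigma>\<^sup>2)\<^sup>2 / t\<^sup>2"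
      unfolding \<sigma>2 by (intro divide_right_mono integral_eps_sum_fourth_le) simp
    moreover have "\<sigma>\<^sup>2 - 3 * (\<sigma>\<^sup>2)\<^sup>2 / t\<^sup>2 = t\<^sup>2 / 16"
      using \<sigma> by (simp add: t_def field_simps power2_eq_square)
    ultimately have "t\<^sup>2 / 16 \<le> t powr (2 - q) * E"
      by linarith
    \<comment> \<open>The factor \<open>t powr (q - 2)\<close> isolates \<open>E\<close> and turns
      \<open>t\<^sup>2\<close> into \<open>t powr q\<close>.\<close>
    then have "t powr (q - 2) * (t powr 2 * (1 / 16)) \<le> t powr (q - 2) * (t powr (2 - q) * E)"
      using t by (intro mult_left_mono) auto
    moreover have "t powr (q - 2) * t powr 2 = t powr q" "t powr (q - 2) * t powr (2 - q) = 1"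
      unfolding powr_add[symmetric] using t by simp_all
    ultimately have "t powr q * (1 / 16) \<le> E"
      by (simp only: mult.assoc[symmetric] mult_1)
    then have "(t powr q * (1 / 16)) powr (1 / q) \<le> E powr (1 / q)"
      using q by (intro powr_mono2) auto
    moreover have "(t powr q * (1 / 16)) powr (1 / q) = 2 * (1 / 16) powr (1 / q) * \<sigma>"
      unfolding powr_mult powr_powr using q t by (simp add: t_def)
    ultimately show ?thesis
      by (simp only: khin_moment_def E_def \<sigma>_def)
  qed
qed

section \<open>The optimal Khinchine constant\<close>

context
  fixes K :: scalar_field and q :: real
  assumes q: "0 < q" "q \<le> 2"
begin

text \<open>Tested on the single coefficient 1, whose moment is 1 because signs have modulus
  1.\<close>

lemma khin_const_candidate_le_1:
  assumes "\<forall>N a. (\<forall>j. in_field K (a j)) \<longrightarrow> A * sqrt (\<Sum>j<N. (norm (a j))\<^sup>2) \<le> khin_moment K q N a"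
  shows "A \<le> 1"
proof -
  interpret prob_space "eps_prod K 1"
    by (rule prob_space_eps_prod)
  have "(\<integral>e. norm (e 0) powr q \<partial>eps_prod K 1) = (\<integral>e. 1 \<partial>eps_prod K 1)"
  proof (rule integral_cong_AE)
    show "(\<lambda>e. norm (e 0) powr q) \<in> borel_measurable (eps_prod K 1)"
      using borel_measurable_eps_sum[where N = 1 and a = "\<lambda>_. 1" and K = K] by simp
    show "AE e in eps_prod K 1. norm (e 0) powr q = 1"
      using AE_eps_prod by eventually_elim simp
  qed simp
  then have "khin_moment K q 1 (\<lambda>_. 1) = 1"
    using q by (simp add: khin_moment_def prob_space[unfolded One_nat_def])
  moreover have "\<forall>j::nat. in_field K ((\<lambda>_. 1) j)"
    by (simp add: in_field_def)
  ultimately show ?thesis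
    using assms[rule_format, of "\<lambda>_. 1" 1] by (simp add: in_field_def)
qed

lemma khin_const_bdd_above:
  "bdd_above {A. \<forall>N a. (\<forall>j. in_field K (a j)) \<longrightarrow>
     A * sqrt (\<Sum>j<N. (norm (a j))\<^sup>2) \<le> khin_moment K q N a}"
  using khin_const_candidate_le_1 by (intro bdd_aboveI[of _ 1]) blast

lemma khin_const_candidate:
  "2 * (1 / 16) powr (1 / q) \<in> {A. \<forall>N a. (\<forall>j. in_field K (a j)) \<longrightarrow>
     A * sqrt (\<Sum>j<N. (norm (a j))\<^sup>2) \<le> khin_moment K q N a}"
  using khin_moment_lower_bound[OF q] by blast

lemma khin_const_pos: "0 < khin_const K q"
proof -
  have "0 < 2 * (1 / 16) powr (1 / q)"
    by simp
  also have "\<dots> \<le> khin_const K q"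
    unfolding khin_const_def by (rule cSup_upper[OF khin_const_candidate khin_const_bdd_above])
  finally show ?thesis .
qed

text \<open>This makes the inverses at least 1, as the constraint \<open>C \<ge> 1\<close> in
  \<open>BH_const\<close> demands of their product.\<close>

lemma khin_const_le_1: "khin_const K q \<le> 1"
  unfolding khin_const_def
  by (rule cSup_least) (use khin_const_candidate khin_const_candidate_le_1 in blast)+

text \<open>The supremum is itself admissible: for a fixed nonzero sequence, every admissible
  constant is at most the same quotient.\<close>

lemma khinchine:
  assumes "\<And>j. in_field K (a j)"
  shows "khin_const K q * sqrt (\<Sum>j<N. (norm (a j))\<^sup>2) \<le> khin_moment K q N a"
proof (cases "sqrt (\<Sum>j<N. (norm (a j))\<^sup>2) = 0")
  case True
  then show ?thesis
    by (simp add: khin_moment_def)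
next
  case False
  then have pos: "0 < sqrt (\<Sum>j<N. (norm (a j))\<^sup>2)"
    by (simp add: sum_nonneg less_le)
  have "khin_const K q \<le> khin_moment K q N a / sqrt (\<Sum>j<N. (norm (a j))\<^sup>2)"
    unfolding khin_const_def
  proof (rule cSup_least)
    show "{A. \<forall>N a. (\<forall>j. in_field K (a j)) \<longrightarrow>
        A * sqrt (\<Sum>j<N. (norm (a j))\<^sup>2) \<le> khin_moment K q N a} \<noteq> {}"
      using khin_const_candidate by blast
  qed (use pos assms in \<open>auto simp: pos_le_divide_eq\<close>)
  then show ?thesis
    using pos by (simp add: pos_le_divide_eq)
qed

end

subsection \<open>The Bohnenblust--Hille inequality\<close>

text \<open>For fixed \<open>t\<close>, \<open>slice n k e c t\<close> is a random sum with
  coefficients \<open>c (insert_at k j t)\<close>, to which Khinchine's inequality applies. After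
  the sum over \<open>t\<close> is moved inside the expectation, \<open>BH\<close> holds for almost
  every fixed \<open>e\<close>, and slicing does not increase the norm.\<close>

lemma khinchine_slices:
  fixes p C :: real
  assumes p: "0 < p" "p \<le> 2" and C: "0 \<le> C" and k: "k \<le> m" and c: "\<And>js. in_field K (c js)"
    and BH: "\<And>c. (\<And>js. in_field K (c js)) \<Longrightarrow>
      (\<Sum>t\<in>idx m n. norm (c t) powr p) powr (1 / p) \<le> C * form_norm K m n c"
  shows "(\<Sum>t\<in>idx m n. (\<Sum>j<n. (norm (c (insert_at k j t)))\<^sup>2) powr (p / 2)) powr (1 / p)
    \<le> C * inverse (khin_const K p) * form_norm K (Suc m) n c"
proof -
  interpret prob_space "eps_prod K n"
    by (rule prob_space_eps_prod)
  define A where "A = khin_const K p"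
  define F where "F = form_norm K (Suc m) n c"
  define X where "X = (\<Sum>t\<in>idx m n. (\<Sum>j<n. (norm (c (insert_at k j t)))\<^sup>2) powr (p / 2))"
  have A: "0 < A"
    using khin_const_pos p by (simp add: A_def)
  have F: "0 \<le> F"
    by (simp add: F_def form_norm_nonneg)
  have int: "integrable (eps_prod K n) (\<lambda>e. norm (slice n k e c t) powr p)" for t
    unfolding slice_def using p by (intro integrable_eps_sum_powr) simp
  have moment: "A powr p * (\<Sum>j<n. (norm (c (insert_at k j t)))\<^sup>2) powr (p / 2)
      \<le> (\<integral>e. norm (slice n k e c t) powr p \<partial>eps_prod K n)" (is "_ * ?s powr _ \<le> ?I") for t
  proof -
    have "A * sqrt ?s \<le> ?I powr (1 / p)"
      using khinchine[OF p, of K "\<lambda>j. c (insert_at k j t)" n] c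
      by (simp add: A_def khin_moment_def slice_def)
    then have "(A * sqrt ?s) powr p \<le> (?I powr (1 / p)) powr p"
      using A p by (intro powr_mono2) (auto simp: sum_nonneg)
    then show ?thesis
      using p by (simp add: powr_mult powr_powr sum_nonneg flip: powr_half_sqrt)
  qed
  have "A powr p * X \<le> (\<Sum>t\<in>idx m n. \<integral>e. norm (slice n k e c t) powr p \<partial>eps_prod K n)"
    unfolding X_def sum_distrib_left by (intro sum_mono moment)
  also have "\<dots> = (\<integral>e. (\<Sum>t\<in>idx m n. norm (slice n k e c t) powr p) \<partial>eps_prod K n)"
    by (rule Bochner_Integration.integral_sum[symmetric]) (rule int)
  also have "\<dots> \<le> (\<integral>e. (C * F) powr p \<partial>eps_prod K n)"
  proof (rule integral_mono_AE)
    show "AE e in eps_prod K n. (\<Sum>t\<in>idx m n. norm (slice n k e c t) powr p) \<le> (C * F) powr p"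
      using AE_eps_prod
    proof eventually_elim
      case (elim e)
      have "(\<Sum>t\<in>idx m n. norm (slice n k e c t) powr p) powr (1 / p) \<le> C * form_norm K m n (slice n k e c)"
        by (rule BH, rule in_field_slice) (use c elim in auto)
      also have "\<dots> \<le> C * F"
        unfolding F_def using C k elim by (intro mult_left_mono form_norm_slice_le) auto
      finally have "((\<Sum>t\<in>idx m n. norm (slice n k e c t) powr p) powr (1 / p)) powr p \<le> (C * F) powr p"
        using p by (intro powr_mono2) auto
      then show ?case
        using p by (simp add: powr_powr sum_nonneg)
    qed
  qed (use int in auto)
  also have "\<dots> = (C * F) powr p"
    by (simp add: prob_space)
  finally have "(A powr p * X) powr (1 / p) \<le> ((C * F) powr p) powr (1 / p)"
    using p by (intro powr_mono2) (auto simp: X_def sum_nonneg)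
  then have "A * X powr (1 / p) \<le> C * F"
    using p A C F by (simp add: powr_mult powr_powr)
  then show ?thesis
    using A by (simp add: X_def[symmetric] A_def[symmetric] F_def[symmetric] field_simps)
qed

text \<open>The point \<open>(1/q\<^sub>0, \<dots>, 1/q\<^sub>m)\<close> is the convex combination, with weights \<open>\<theta>\<close>, of the points whose
  \<open>k\<close>-th coordinate is \<open>1/2\<close> and whose other coordinates are \<open>1/p\<close>.\<close>

lemma mixed_norm_le:
  fixes p C :: real
  assumes m: "1 \<le> m" and p: "p = 2 * real m / (real m + 1)" and C: "0 \<le> C"
    and q: "\<And>k. k \<le> m \<Longrightarrow> p \<le> q k \<and> q k \<le> 2"
    and sum_q: "(\<Sum>k<Suc m. 1 / q k) = (real (Suc m) + 1) / 2"
    and c: "\<And>js. in_field K (c js)"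
    and BH: "\<And>c. (\<And>js. in_field K (c js)) \<Longrightarrow>
      (\<Sum>t\<in>idx m n. norm (c t) powr p) powr (1 / p) \<le> C * form_norm K m n c"
  shows "mixed_norm (Suc m) q n c \<le> C * inverse (khin_const K p) * form_norm K (Suc m) n c"
proof -
  define D where "D = C * inverse (khin_const K p) * form_norm K (Suc m) n c"
  \<comment> \<open>Solves \<open>1 / q k = 1 / p - \<theta> k * (1 / p - 1 / 2)\<close>. The
    weights are nonnegative because \<open>p \<le> q k\<close>, and \<open>sum_q\<close> makes them
    sum to 1.\<close>
  define \<theta> where "\<theta> = (\<lambda>k. (1 / p - 1 / q k) / (1 / p - 1 / 2))"
  define v where "v = (\<lambda>k i::nat. if i = k then 2 else p)"
  let ?S = "{..<Suc m}"
  have p_bounds: "0 < p" "p < 2"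
    using m by (auto simp: p field_simps)
  have gap: "1 / p - 1 / 2 = 1 / (2 * real m)"
    using m by (simp add: p field_simps)
  have D: "0 \<le> D"
    using C khin_const_pos[of p K] p_bounds by (simp add: D_def form_norm_nonneg)
  have q_pos: "0 < q k" if "k \<le> m" for k
    using q[OF that] p_bounds by simp
  have \<theta>0: "0 \<le> \<theta> k" if "k \<in> ?S" for k
  proof -
    have "1 / q k \<le> 1 / p"
      using q[of k] that p_bounds by (intro divide_left_mono) auto
    then show ?thesis
      by (simp add: \<theta>_def gap)
  qed
  have "sum \<theta> ?S = (real (Suc m) / p - (real (Suc m) + 1) / 2) * (2 * real m)"
    unfolding \<theta>_def sum_divide_distrib[symmetric] sum_subtractf sum_q gap by simp
  also have "\<dots> = 1"
    using m by (simp add: p field_simps)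
  finally have \<theta>1: "sum \<theta> ?S = 1" .
  have "mixnorm q n (\<lambda>js. norm (c js)) (Suc m) []
      \<le> (\<Prod>k\<in>?S. mixnorm (v k) n (\<lambda>js. norm (c js)) (Suc m) [] powr \<theta> k)"
  proof (rule mixnorm_interpolate)
    fix i assume "i < length ([]::nat list) + Suc m"
    then have i: "i \<in> ?S"
      by simp
    have "(\<Sum>k\<in>?S. \<theta> k / v k i) = \<theta> i / 2 + (\<Sum>k\<in>?S - {i}. \<theta> k / p)"
      using i by (subst sum.remove[of _ i]) (auto simp: v_def intro!: sum.cong)
    also have "(\<Sum>k\<in>?S - {i}. \<theta> k / p) = (1 - \<theta> i) / p"
      using i \<theta>1 by (simp add: sum_diff1 flip: sum_divide_distrib)
    also have "\<theta> i / 2 + (1 - \<theta> i) / p = 1 / p - \<theta> i * (1 / p - 1 / 2)"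
      by (simp add: algebra_simps diff_divide_distrib)
    also have "\<dots> = 1 / q i"
      using m by (simp add: \<theta>_def gap)
    finally show "1 / q i = (\<Sum>k\<in>?S. \<theta> k / v k i)"
      by simp
  qed (use \<theta>0 \<theta>1 p_bounds q_pos in \<open>auto simp: v_def\<close>)
  \<comment> \<open>Every endpoint norm has the same bound \<open>D\<close>, whichever slot carries
    the exponent 2, so the interpolated bound is \<open>D\<close> again.\<close>
  also have "\<dots> \<le> (\<Prod>k\<in>?S. D powr \<theta> k)"
  proof (intro prod_mono conjI powr_mono2 mixnorm_nonneg)
    fix k assume "k \<in> ?S"
    then have k: "k \<le> m"
      by simp
    have "mixnorm (v k) n (\<lambda>js. norm (c js)) (Suc m) []
        \<le> (\<Sum>t\<in>idx m n. (\<Sum>j<n. (norm (c ([] @ insert_at k j t)))\<^sup>2) powr (p / 2)) powr (1 / p)"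
      by (rule mixnorm_single_two_le) (use k p_bounds in \<open>auto simp: v_def\<close>)
    also have "\<dots> \<le> D"
      unfolding D_def append_Nil
      by (rule khinchine_slices) (use p_bounds C k c BH in auto)
    finally show "mixnorm (v k) n (\<lambda>js. norm (c js)) (Suc m) [] \<le> D" .
  qed (use \<theta>0 in auto)
  also have "\<dots> = D"
  proof (cases "D = 0")
    case False
    then have "(\<Prod>k\<in>?S. D powr \<theta> k) = D powr sum \<theta> ?S"
      by (rule powr_sum[symmetric])
    then show ?thesis
      using D by (simp only: \<theta>1) simp
  qed simp
  finally show ?thesis
    by (simp add: mixed_norm_def D_def)
qed

text \<open>Induction on \<open>m\<close>, starting from exponent 1 and the empty product. Passing
  to \<open>Suc m\<close> slots uses \<open>mixed_norm_le\<close> with all exponents equal to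
  \<open>r\<close> and contributes the factor with \<open>j = Suc m\<close>.\<close>

lemma bohnenblust_hille:
  assumes "1 \<le> m" and "\<And>js. in_field K (c js)"
  shows "(\<Sum>t\<in>idx m n. norm (c t) powr (2 * real m / (real m + 1))) powr (1 / (2 * real m / (real m + 1)))
    \<le> (\<Prod>j\<in>{2..m}. inverse (khin_const K ((2 * real j - 2) / real j))) * form_norm K m n c"
  using assms
proof (induction m arbitrary: c rule: nat_induct_at_least)
  case base
  then show ?case
    using sum_norm_coeffs_le_form_norm[of K c n] by (simp add: sum_nonneg)
next
  case (Suc m)
  define p where "p = 2 * real m / (real m + 1)"
  define r where "r = 2 * real (Suc m) / (real (Suc m) + 1)"
  define C where "C = (\<Prod>j\<in>{2..m}. inverse (khin_const K ((2 * real j - 2) / real j)))"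
  have r: "0 < r" "p \<le> r" "r \<le> 2"
    by (auto simp: p_def r_def field_simps)
  have "0 \<le> C"
    unfolding C_def by (intro prod_nonneg) (auto intro!: less_imp_le khin_const_pos simp: field_simps)
  have "mixed_norm (Suc m) (\<lambda>_. r) n c \<le> C * inverse (khin_const K p) * form_norm K (Suc m) n c"
  proof (rule mixed_norm_le)
    show "(\<Sum>k<Suc m. 1 / r) = (real (Suc m) + 1) / 2"
      by (simp add: r_def field_simps)
  qed (use Suc r \<open>0 \<le> C\<close> in \<open>auto simp: p_def C_def\<close>)
  moreover have "mixed_norm (Suc m) (\<lambda>_. r) n c = (\<Sum>t\<in>idx (Suc m) n. norm (c t) powr r) powr (1 / r)"
    unfolding mixed_norm_def using r by (subst mixnorm_const_exponent[where p = r]) auto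
  moreover have "{2..Suc m} = insert (Suc m) {2..m}"
    using Suc.hyps by auto
  moreover have "(2 * real (Suc m) - 2) / real (Suc m) = p"
    by (simp add: p_def field_simps)
  ultimately have "(\<Sum>t\<in>idx (Suc m) n. norm (c t) powr r) powr (1 / r)
      \<le> (\<Prod>j\<in>{2..Suc m}. inverse (khin_const K ((2 * real j - 2) / real j))) * form_norm K (Suc m) n c"
    by (simp add: C_def mult.commute)
  then show ?case
    by (simp only: r_def)
qed

section \<open>Mixed inequalities with varying exponents\<close>

theorem mainTheorem3:
  fixes K :: scalar_field and m :: nat and q :: "nat \<Rightarrow> real"
  assumes "m \<ge> 2"
    and "\<forall>k<m. 1 \<le> q k \<and> q k \<le> 2"
    and "(\<Sum>k<m. 1 / q k) = (real m + 1) / 2"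
    and "Max (q ` {..<m}) < (2 * (real m)\<^sup>2 - 4 * real m + 2) / ((real m)\<^sup>2 - real m - 1)"
  shows "BH_const K m q \<le> (\<Prod>j\<in>{2..m}. inverse (khin_const K ((2 * real j - 2) / real j)))"
proof -
  obtain m' where m': "m = Suc m'" "1 \<le> m'"
    using assms(1) by (cases m) auto
  define p where "p = 2 * real m' / (real m' + 1)"
  define C where "C = (\<Prod>j\<in>{2..m'}. inverse (khin_const K ((2 * real j - 2) / real j)))"
  \<comment> \<open>In terms of \<open>x = m - 1\<close> the bound on the maximum reads
    \<open>2 * x\<^sup>2 / (x\<^sup>2 + x - 1)\<close>.\<close>
  define x where "x = real m'"
  have x: "1 \<le> x"
    using m' by (simp add: x_def)
  have A: "1 \<le> inverse (khin_const K ((2 * real j - 2) / real j))" if "2 \<le> j" for j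
    using that by (intro one_le_inverse khin_const_pos khin_const_le_1) (auto simp: field_simps)
  have "0 \<le> C"
    unfolding C_def by (intro prod_nonneg order_trans[OF zero_le_one A]) auto
  have den: "0 < x\<^sup>2 + x - 1"
    using x one_le_power[OF x, of 2] by linarith
  have q_lt: "q k < 2 * x\<^sup>2 / (x\<^sup>2 + x - 1)" if "k < m" for k
  proof -
    have "q k \<le> Max (q ` {..<m})"
      using that by (intro Max_ge) auto
    also have "\<dots> < (2 * (real m)\<^sup>2 - 4 * real m + 2) / ((real m)\<^sup>2 - real m - 1)"
      by (rule assms(4))
    also have "\<dots> = 2 * x\<^sup>2 / (x\<^sup>2 + x - 1)"
      by (simp add: m' x_def power2_eq_square algebra_simps)
    finally show ?thesis .
  qed
  text \<open>If all the other exponents are below the bound, the condition on the sum forces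
    \<open>1 / q k \<le> 1 / p\<close>.\<close>
  have p_le: "p \<le> q k" if k: "k < m" for k
  proof -
    have "(x\<^sup>2 + x - 1) / (2 * x\<^sup>2) \<le> 1 / q i" if "i < m" for i
    proof -
      have "0 < q i"
        using assms(2) that by (smt (verit))
      then show ?thesis
        using q_lt[OF that] den x by (simp add: field_simps)
    qed
    then have "(\<Sum>i\<in>{..<m} - {k}. (x\<^sup>2 + x - 1) / (2 * x\<^sup>2)) \<le> (\<Sum>i\<in>{..<m} - {k}. 1 / q i)"
      by (intro sum_mono) auto
    moreover have "(\<Sum>i\<in>{..<m} - {k}. (x\<^sup>2 + x - 1) / (2 * x\<^sup>2)) = x * ((x\<^sup>2 + x - 1) / (2 * x\<^sup>2))"
      using k by (simp add: m' x_def)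
    moreover have "(\<Sum>i\<in>{..<m} - {k}. 1 / q i) = (x + 2) / 2 - 1 / q k"
      using k assms(3) by (simp add: sum_diff1 m' x_def)
    ultimately have "1 / q k \<le> (x + 2) / 2 - x * ((x\<^sup>2 + x - 1) / (2 * x\<^sup>2))"
      by linarith
    \<comment> \<open>This is exactly \<open>1 / p\<close>: the bound on the maximum is tuned to
      this value.\<close>
    also have "\<dots> = (x + 1) / (2 * x)"
      using x by (simp add: field_simps power2_eq_square)
    finally have "1 / q k \<le> (x + 1) / (2 * x)" .
    moreover have "0 < q k"
      using assms(2) k by (smt (verit))
    ultimately show ?thesis
      using x by (simp add: p_def x_def[symmetric] field_simps)
  qed
  have C_prod: "(\<Prod>j\<in>{2..m}. inverse (khin_const K ((2 * real j - 2) / real j))) = C * inverse (khin_const K p)"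
  proof -
    have "{2..m} = insert m {2..m'}"
      using m' by auto
    moreover have "(2 * real m - 2) / real m = p"
      by (simp add: m' p_def field_simps)
    ultimately show ?thesis
      by (simp add: C_def m'(1) mult.commute)
  qed
  have "mixed_norm m q n c \<le> C * inverse (khin_const K p) * form_norm K m n c"
    if "\<forall>js. in_field K (c js)" for n c
    unfolding m'(1)
  proof (rule mixed_norm_le[OF m'(2) p_def \<open>0 \<le> C\<close>])
    show "(\<Sum>t\<in>idx m' n. norm (c t) powr p) powr (1 / p) \<le> C * form_norm K m' n c"
      if "\<And>js. in_field K (c js)" for c
      unfolding p_def C_def using m'(2) that by (rule bohnenblust_hille)
  qed (use assms m' p_le that in auto)
  \<comment> \<open>Membership in the set defining \<open>BH_const\<close> includes being at least
    1.\<close>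
  moreover have "1 \<le> (\<Prod>j\<in>{2..m}. inverse (khin_const K ((2 * real j - 2) / real j)))"
    using A by (intro prod_ge_1) auto
  ultimately show ?thesis
    unfolding BH_const_def by (intro cInf_lower bdd_belowI[of _ 1]) (auto simp: C_prod)
qed

end
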